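(* Let $(E,(\cdot,\cdot),\mathcal H)$ be an extended affine Lie algebra with core $E_c$, and let $\tau$ be a finite order automorphism of $E$ such that the restriction of $\tau$ to $E_c$ is a Chevalley involution for $E_c$. Then $\tau$ is a Chevalley involution for $E$ if and only if $\tau$ stabilizes $\mathcal H$. In particular, if $E$ is an affine Kac-Moody Lie algebra, then a finite order automorphism $\tau$ of $E$ is a Chevalley involution for $E$ if and only if its restriction to $E_c$ is a Chevalley involution for $E_c$.
   Context: All vector spaces are over $\mathbb C$. An extended affine Lie algebra is a triple $(E,(\cdot,\cdot),\mathcal H)$ where $E$ is a Lie algebra, $\mathcal H$ is a non-trivial finite dimensional subalgebra and $(\cdot,\cdot)$ is a symmetric bilinear form on $E$ such that: (A1) the form is invariant and non-degenerate; (A2) $E=\sum_{\alpha\in R}E_\alpha$ with $E_\alpha=\{x\in E\mid [h,x]=\alpha(h)x\ \forall h\in\mathcal H\}$, $R=\{\alpha\in\mathcal H^\star\mid E_\alpha\neq\{0\}\}$ and $E_0=\mathcal H$ ($R$ is the root system of $E$); the form restricted to $\mathcal H$ is then non-degenerate, $t_\alpha\in\mathcal H$ is defined by $\alpha(h)=(h,t_\alpha)$, and $(\alpha,\beta):=(t_\alpha,t_\beta)$ on $\mathcal H^\star$; $R^0=\{\alpha\in R\mid(\alpha,\alpha)=0\}$ (isotropic roots), $R^\times=R\setminus R^0$ (non-isotropic roots), and the core $E_c$ is the subalgebra generated by $E_\alpha$, $\alpha\in R^\times$; (A3) $\mathrm{ad}(x)$ is locally nilpotent for $x\in E_\alpha$,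 $\alpha\in R^\times$; (A4) (tameness) the centralizer of $E_c$ in $E$ is contained in $E_c$; (A5) the $\mathbb Z$-span of $R$ is a free abelian group of finite rank; (A6) if $R^\times=R_1\uplus R_2$ with $R_1,R_2$ non-empty then $R_1\not\perp R_2$. A finite order automorphism $\tau$ of $E$ is a Chevalley involution for $E$ if $\tau(E_\alpha)=E_{-\alpha}$ for all $\alpha\in R$ (equivalently, $\tau(h)=-h$ for all $h\in\mathcal H$). A finite order automorphism $\tau$ of $E_c$ is a Chevalley involution for $E_c$ if $\tau(E_\alpha)=E_{-\alpha}$ for all $\alpha\in R^\times$. It is known that every automorphism of $E$ stabilizes $E_c$. An affine Kac-Moody Lie algebra is regarded as an extended affine Lie algebra with its standard Cartan subalgebra and invariant form. *)

theory Defs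
  imports "HOL-Analysis.Analysis" "HOL-Library.Function_Algebras" "HOL-Library.FuncSet"
begin

section \<open>Complex Lie algebras\<close>

locale lie_algebra = vector_space scale
  for scale :: "complex \<Rightarrow> 'a::ab_group_add \<Rightarrow> 'a" +
  fixes bracket :: "'a \<Rightarrow> 'a \<Rightarrow> 'a"
  assumes bracket_linear_left: "Vector_Spaces.linear scale scale (\<lambda>x. bracket x y)"
    and bracket_linear_right: "Vector_Spaces.linear scale scale (bracket x)"
    and bracket_self: "bracket x x = 0"
    and jacobi: "bracket x (bracket y z) + bracket y (bracket z x) + bracket z (bracket x y) = 0"
begin

definition lie_subalgebra :: "'a set \<Rightarrow> bool" where
  "lie_subalgebra S \<longleftrightarrow> subspace S \<and> (\<forall>x\<in>S. \<forall>y\<in>S. bracket x y \<in> S)"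

definition lie_ideal :: "'a set \<Rightarrow> bool" where
  "lie_ideal I \<longleftrightarrow> subspace I \<and> (\<forall>x. \<forall>y\<in>I. bracket x y \<in> I)"

definition generated_subalgebra :: "'a set \<Rightarrow> 'a set" where
  "generated_subalgebra X = lie_subalgebra hull X"

definition centralizer :: "'a set \<Rightarrow> 'a set" where
  "centralizer S = {x. \<forall>y\<in>S. bracket x y = 0}"

definition ad_locally_nilpotent :: "'a \<Rightarrow> bool" where
  "ad_locally_nilpotent x \<longleftrightarrow> (\<forall>y. \<exists>n. (bracket x ^^ n) y = 0)"

text \<open>Automorphisms of a subalgebra \<open>S\<close>; only the values of \<open>\<tau>\<close> on \<open>S\<close> matter.
  The whole algebra is the case \<open>S = UNIV\<close>.\<close>

definition lie_automorphism_on :: "'a set \<Rightarrow> ('a \<Rightarrow> 'a) \<Rightarrow> bool" where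
  "lie_automorphism_on S \<tau> \<longleftrightarrow>
     bij_betw \<tau> S S \<and>
     (\<forall>x\<in>S. \<forall>y\<in>S. \<tau> (x + y) = \<tau> x + \<tau> y) \<and>
     (\<forall>c. \<forall>x\<in>S. \<tau> (scale c x) = scale c (\<tau> x)) \<and>
     (\<forall>x\<in>S. \<forall>y\<in>S. \<tau> (bracket x y) = bracket (\<tau> x) (\<tau> y))"

definition finite_order_automorphism_on :: "'a set \<Rightarrow> ('a \<Rightarrow> 'a) \<Rightarrow> bool" where
  "finite_order_automorphism_on S \<tau> \<longleftrightarrow>
     lie_automorphism_on S \<tau> \<and> (\<exists>n>0. \<forall>x\<in>S. (\<tau> ^^ n) x = x)"

end

section \<open>Root data relative to a subalgebra and a form\<close>

locale lie_algebra_with_form = lie_algebra scale bracket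
  for scale :: "complex \<Rightarrow> 'a::ab_group_add \<Rightarrow> 'a"
    and bracket :: "'a \<Rightarrow> 'a \<Rightarrow> 'a" +
  fixes form :: "'a \<Rightarrow> 'a \<Rightarrow> complex"
    and H :: "'a set"
begin

text \<open>The dual space of \<open>H\<close>. Each functional on \<open>H\<close> is represented by its extension by zero,
  which makes the representation unique and closed under the pointwise operations.\<close>

definition dual :: "('a \<Rightarrow> complex) set" where
  "dual = {\<alpha>. (\<forall>x\<in>H. \<forall>y\<in>H. \<alpha> (x + y) = \<alpha> x + \<alpha> y) \<and>
              (\<forall>c. \<forall>x\<in>H. \<alpha> (scale c x) = c * \<alpha> x) \<and>
              (\<forall>x. x \<notin> H \<longrightarrow> \<alpha> x = 0)}"

definition root_space :: "('a \<Rightarrow> complex) \<Rightarrow> 'a set" where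
  "root_space \<alpha> = {x. \<forall>h\<in>H. bracket h x = scale (\<alpha> h) x}"

definition roots :: "('a \<Rightarrow> complex) set" where
  "roots = {\<alpha> \<in> dual. root_space \<alpha> \<noteq> {0}}"

definition representing_vector :: "('a \<Rightarrow> complex) \<Rightarrow> 'a" where
  "representing_vector \<alpha> = (THE t. t \<in> H \<and> (\<forall>h\<in>H. \<alpha> h = form h t))"

definition dual_form :: "('a \<Rightarrow> complex) \<Rightarrow> ('a \<Rightarrow> complex) \<Rightarrow> complex" where
  "dual_form \<alpha> \<beta> = form (representing_vector \<alpha>) (representing_vector \<beta>)"

definition isotropic_roots :: "('a \<Rightarrow> complex) set" where
  "isotropic_roots = {\<alpha> \<in> roots. dual_form \<alpha> \<alpha> = 0}"

definition nonisotropic_roots :: "('a \<Rightarrow> complex) set" where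
  "nonisotropic_roots = roots - isotropic_roots"

definition core :: "'a set" where
  "core = generated_subalgebra (\<Union>\<alpha>\<in>nonisotropic_roots. root_space \<alpha>)"

definition chevalley_involution :: "('a \<Rightarrow> 'a) \<Rightarrow> bool" where
  "chevalley_involution \<tau> \<longleftrightarrow>
     finite_order_automorphism_on UNIV \<tau> \<and>
     (\<forall>\<alpha>\<in>roots. \<tau> ` root_space \<alpha> = root_space (- \<alpha>))"

definition core_chevalley_involution :: "('a \<Rightarrow> 'a) \<Rightarrow> bool" where
  "core_chevalley_involution \<tau> \<longleftrightarrow>
     finite_order_automorphism_on core \<tau> \<and>
     (\<forall>\<alpha>\<in>nonisotropic_roots. \<tau> ` root_space \<alpha> = root_space (- \<alpha>))"

end

section \<open>Extended affine Lie algebras\<close>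

definition int_scale :: "int \<Rightarrow> ('a \<Rightarrow> complex) \<Rightarrow> ('a \<Rightarrow> complex)" where
  "int_scale k \<alpha> = (\<lambda>x. of_int k * \<alpha> x)"

locale extended_affine_lie_algebra = lie_algebra_with_form scale bracket form H
  for scale :: "complex \<Rightarrow> 'a::ab_group_add \<Rightarrow> 'a"
    and bracket :: "'a \<Rightarrow> 'a \<Rightarrow> 'a"
    and form :: "'a \<Rightarrow> 'a \<Rightarrow> complex"
    and H :: "'a set" +
  assumes H_subalgebra: "lie_subalgebra H"
    and H_nontrivial: "H \<noteq> {0}"
    and H_finite_dimensional: "\<exists>B. finite B \<and> span B = H"
    and form_symmetric: "form x y = form y x"
    and form_linear: "Vector_Spaces.linear scale (*) (form x)"
    and form_invariant: "form (bracket x y) z = form x (bracket y z)"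
    and form_nondegenerate: "(\<And>y. form x y = 0) \<Longrightarrow> x = 0"
    and root_space_sum: "span (\<Union>\<alpha>\<in>roots. root_space \<alpha>) = UNIV"
    and root_space_zero: "root_space (\<lambda>_. 0) = H"
    and nonisotropic_locally_nilpotent:
      "\<alpha> \<in> nonisotropic_roots \<Longrightarrow> x \<in> root_space \<alpha> \<Longrightarrow> ad_locally_nilpotent x"
    and tame: "centralizer core \<subseteq> core"
    and root_lattice_free_finite_rank:
      "\<exists>B. finite B \<and> \<not> module.dependent int_scale B \<and>
           module.span int_scale B = module.span int_scale roots"
    and nonisotropic_irreducible:
      "nonisotropic_roots = R1 \<union> R2 \<Longrightarrow> R1 \<inter> R2 = {} \<Longrightarrow> R1 \<noteq> {} \<Longrightarrow> R2 \<noteq> {} \<Longrightarrow>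
       \<exists>\<alpha>\<in>R1. \<exists>\<beta>\<in>R2. dual_form \<alpha> \<beta> \<noteq> 0"

section \<open>Affine Kac-Moody Lie algebras\<close>

definition generalized_cartan_matrix :: "int^'i^'i \<Rightarrow> bool" where
  "generalized_cartan_matrix A \<longleftrightarrow>
     (\<forall>i. A $ i $ i = 2) \<and>
     (\<forall>i j. i \<noteq> j \<longrightarrow> A $ i $ j \<le> 0) \<and>
     (\<forall>i j. A $ i $ j = 0 \<longrightarrow> A $ j $ i = 0)"

definition indecomposable_matrix :: "int^'i^'i \<Rightarrow> bool" where
  "indecomposable_matrix A \<longleftrightarrow>
     (\<forall>J. J \<noteq> {} \<longrightarrow> J \<noteq> UNIV \<longrightarrow> (\<exists>i\<in>J. \<exists>j\<in>-J. A $ i $ j \<noteq> 0 \<or> A $ j $ i \<noteq> 0))"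

definition real_matrix :: "int^'i^'i \<Rightarrow> real^'i^'i" where
  "real_matrix A = (\<chi> i j. real_of_int (A $ i $ j))"

text \<open>Affine type in the finite/affine/indefinite trichotomy of indecomposable generalized
  Cartan matrices: corank one, a strictly positive null vector, and \<open>A v \<ge> 0\<close> only if
  \<open>A v = 0\<close>.\<close>

definition affine_cartan_matrix :: "int^'i^'i \<Rightarrow> bool" where
  "affine_cartan_matrix A \<longleftrightarrow>
     generalized_cartan_matrix A \<and> indecomposable_matrix A \<and>
     rank (real_matrix A) + 1 = CARD('i) \<and>
     (\<exists>u. (\<forall>i. u $ i > 0) \<and> real_matrix A *v u = 0) \<and>
     (\<forall>v. (\<forall>i. (real_matrix A *v v) $ i \<ge> 0) \<longrightarrow> real_matrix A *v v = 0)"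

definition linearly_independent_family ::
    "(complex \<Rightarrow> 'b::ab_group_add \<Rightarrow> 'b) \<Rightarrow> ('i::finite \<Rightarrow> 'b) \<Rightarrow> bool" where
  "linearly_independent_family sc v \<longleftrightarrow> (\<forall>c. (\<Sum>i\<in>UNIV. sc (c i) (v i)) = 0 \<longrightarrow> (\<forall>i. c i = 0))"

context lie_algebra_with_form
begin

text \<open>A realization of \<open>A\<close> on \<open>H\<close>, with simple roots \<open>\<alpha>\<close> and simple coroots \<open>\<alpha>v\<close>.
  The last clause is \<open>dim H - n = n - rank A\<close> for an \<open>n \<times> n\<close> matrix \<open>A\<close>.\<close>

definition realization ::
    "int^'i^'i \<Rightarrow> ('i::finite \<Rightarrow> 'a \<Rightarrow> complex) \<Rightarrow> ('i \<Rightarrow> 'a) \<Rightarrow> bool" where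
  "realization A \<alpha> \<alpha>v \<longleftrightarrow>
     (\<exists>B. finite B \<and> span B = H) \<and>
     range \<alpha> \<subseteq> dual \<and> range \<alpha>v \<subseteq> H \<and>
     linearly_independent_family (\<lambda>c \<phi> h. c * \<phi> h) \<alpha> \<and>
     linearly_independent_family scale \<alpha>v \<and>
     (\<forall>i j. \<alpha> j (\<alpha>v i) = of_int (A $ i $ j)) \<and>
     dim H + rank (real_matrix A) = 2 * CARD('i)"

text \<open>The Lie algebra is the Kac-Moody algebra of \<open>A\<close> with standard Cartan subalgebra \<open>H\<close>.
  The first four groups of clauses present it as a quotient of the Lie algebra with generators
  \<open>H\<close>, \<open>e i\<close>, \<open>f i\<close> and the Chevalley relations, by an ideal meeting \<open>H\<close> trivially; the last
  clause says that this ideal is the largest one meeting \<open>H\<close> trivially.\<close>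

definition kac_moody :: "int^'i^'i::finite \<Rightarrow> bool" where
  "kac_moody A \<longleftrightarrow>
     (\<exists>\<alpha> \<alpha>v e f.
        realization A \<alpha> \<alpha>v \<and>
        (\<forall>h\<in>H. \<forall>h'\<in>H. bracket h h' = 0) \<and>
        (\<forall>i j. bracket (e i) (f j) = (if i = j then \<alpha>v i else 0)) \<and>
        (\<forall>h\<in>H. \<forall>i. bracket h (e i) = scale (\<alpha> i h) (e i) \<and>
                     bracket h (f i) = scale (- \<alpha> i h) (f i)) \<and>
        generated_subalgebra (H \<union> range e \<union> range f) = UNIV \<and>
        (\<forall>I. lie_ideal I \<longrightarrow> I \<inter> H = {0} \<longrightarrow> I = {0}))"

text \<open>The defining property does not mention the form: on an affine Kac-Moody algebra a
  nondegenerate invariant symmetric form is a standard one up to a nonzero scalar, so in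
  \<open>extended_affine_lie_algebra\<close> the form of such an algebra needs no further condition.\<close>

definition affine_kac_moody :: "int^'i^'i::finite \<Rightarrow> bool" where
  "affine_kac_moody A \<longleftrightarrow> affine_cartan_matrix A \<and> kac_moody A"

end

end

theory Submission
  imports Defs
begin

text \<open>
  Let \<open>\<tau>\<close> act on the core as a Chevalley involution and let \<open>h \<in> H\<close>. For \<open>x \<in> E\<^sub>\<alpha>\<close> with \<open>\<alpha>\<close>
  non-isotropic, \<open>\<tau> x \<in> E\<^bsub>-\<alpha>\<^esub>\<close>, so \<open>\<tau> h\<close> and \<open>-h\<close> have the same bracket with \<open>\<tau> x\<close>. Hence
  the defect \<open>c = h + \<tau> h\<close> always centralizes the core (\<open>defect_centralizes_core\<close>), and the
  question is when it vanishes.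

  If \<open>\<tau>\<close> stabilizes \<open>H\<close>, then \<open>c\<close> lies in \<open>H\<close> and, by tameness, in the core. The degree zero part
  of the core is spanned by the vectors \<open>t\<^sub>\<alpha>\<close> with \<open>\<alpha>\<close> non-isotropic
  (\<open>core_inter_H_subset_coroot_span\<close>), and \<open>\<tau>\<close> is \<open>-1\<close> on each of them because it maps the line
  \<open>[E\<^sub>\<alpha>, E\<^bsub>-\<alpha>\<^esub>]\<close> to itself and \<open>(\<alpha>, \<alpha>) \<noteq> 0\<close>. So \<open>\<tau> c = -c\<close>, that is \<open>(\<tau> + 1)\<^sup>2 h = 0\<close>. An
  operator of finite order is semisimple, so already \<open>(\<tau> + 1) h = 0\<close>, and an automorphism that is
  \<open>-1\<close> on \<open>H\<close> exchanges \<open>E\<^sub>\<alpha>\<close> and \<open>E\<^bsub>-\<alpha>\<^esub>\<close> for every root.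

  If \<open>E\<close> is a Kac-Moody algebra, then stability of \<open>H\<close> is automatic. The relation
  \<open>\<alpha>\<^sub>i(\<alpha>\<^sub>i\<^sup>\<or>) = 2\<close> makes the simple roots non-isotropic, so the core contains all \<open>e\<^sub>i\<close> and \<open>f\<^sub>i\<close>.
  With \<open>C\<close> the centralizer of the core, \<open>[H, C]\<close> is therefore an ideal; it meets \<open>H\<close> only in \<open>0\<close>
  because it is orthogonal to \<open>H\<close>. So \<open>[H, C] = 0\<close>, which says \<open>C \<subseteq> E\<^sub>0 = H\<close>
  (\<open>centralizer_core_subset_H\<close>), and \<open>\<tau> h = c - h \<in> H\<close>.
\<close>

section \<open>Brackets and generated subalgebras\<close>

context lie_algebra
begin

lemma bracket_add_left: "bracket (x + y) z = bracket x z + bracket y z"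
  and bracket_scale_left: "bracket (scale c x) z = scale c (bracket x z)"
  using bracket_linear_left[of z] by (auto simp: Vector_Spaces.linear_iff)

lemma bracket_add_right: "bracket z (x + y) = bracket z x + bracket z y"
  and bracket_scale_right: "bracket z (scale c x) = scale c (bracket z x)"
  using bracket_linear_right[of z] by (auto simp: Vector_Spaces.linear_iff)

lemma bracket_zero_left [simp]: "bracket 0 z = 0"
  using bracket_scale_left[of 0 0 z] by simp

lemma bracket_zero_right [simp]: "bracket z 0 = 0"
  using bracket_scale_right[of z 0 0] by simp

lemma bracket_minus_left: "bracket (- x) z = - bracket x z"
  using bracket_scale_left[of "-1" x z] by simp

lemma bracket_minus_right: "bracket z (- x) = - bracket z x"
  using bracket_scale_right[of z "-1" x] by simp

lemma bracket_anticommute: "bracket x y = - bracket y x"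
proof -
  have "bracket (x + y) (x + y) = bracket x x + bracket y y + (bracket x y + bracket y x)"
    by (simp only: bracket_add_left bracket_add_right ac_simps)
  then have "bracket x y + bracket y x = 0"
    by (simp only: bracket_self add_0)
  then show ?thesis by (simp add: eq_neg_iff_add_eq_0)
qed

lemma bracket_derivation: "bracket h (bracket x y) = bracket (bracket h x) y + bracket x (bracket h y)"
proof -
  have "bracket y (bracket h x) = - bracket (bracket h x) y"
    by (rule bracket_anticommute)
  moreover have "bracket x (bracket y h) = - bracket x (bracket h y)"
    by (subst bracket_anticommute[of y h]) (rule bracket_minus_right)
  ultimately show ?thesis using jacobi[of h x y]
    by (simp add: algebra_simps)
qed

lemma lie_subalgebra_generated: "lie_subalgebra (generated_subalgebra X)"
  unfolding generated_subalgebra_def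
  by (rule hull_in) (auto simp: lie_subalgebra_def intro!: subspace_Inter)

lemma subset_generated_subalgebra: "X \<subseteq> generated_subalgebra X"
  unfolding generated_subalgebra_def by (rule hull_subset)

lemma generated_subalgebra_minimal:
  "X \<subseteq> S \<Longrightarrow> lie_subalgebra S \<Longrightarrow> generated_subalgebra X \<subseteq> S"
  unfolding generated_subalgebra_def by (rule hull_minimal)

lemma bracket_span_subset:
  assumes "\<And>x. x \<in> X \<Longrightarrow> bracket z x \<in> S" and "subspace S" and "y \<in> span X"
  shows "bracket z y \<in> S"
proof -
  have "subspace {y. bracket z y \<in> S}"
    using assms(2) by (auto simp: subspace_def bracket_add_right bracket_scale_right)
  then have "span X \<subseteq> {y. bracket z y \<in> S}"
    by (intro span_minimal) (use assms(1) in auto)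
  with assms(3) show ?thesis by auto
qed

lemma lie_subalgebra_span:
  assumes "\<And>x y. x \<in> X \<Longrightarrow> y \<in> X \<Longrightarrow> bracket x y \<in> span X"
  shows "lie_subalgebra (span X)"
  unfolding lie_subalgebra_def
proof (intro conjI ballI)
  fix x y assume x: "x \<in> span X" and y: "y \<in> span X"
  have "bracket y z \<in> span X" if "z \<in> X" for z
  proof -
    have "bracket z y \<in> span X"
      using assms that y by (intro bracket_span_subset[OF _ subspace_span y]) auto
    then show ?thesis
      by (subst bracket_anticommute) (rule span_neg)
  qed
  then have "bracket y x \<in> span X"
    by (rule bracket_span_subset[OF _ subspace_span x])
  then show "bracket x y \<in> span X"
    by (subst bracket_anticommute) (rule span_neg)
qed (rule subspace_span)

lemma centralizer_generated_subalgebra: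
  "centralizer (generated_subalgebra X) = centralizer X"
proof
  show "centralizer (generated_subalgebra X) \<subseteq> centralizer X"
    using subset_generated_subalgebra[of X] by (auto simp: centralizer_def)
  show "centralizer X \<subseteq> centralizer (generated_subalgebra X)"
  proof
    fix z assume z: "z \<in> centralizer X"
    have "lie_subalgebra {y. bracket z y = 0}"
      by (auto simp: lie_subalgebra_def subspace_def bracket_add_right bracket_scale_right
          bracket_derivation)
    then have "generated_subalgebra X \<subseteq> {y. bracket z y = 0}"
      using z by (intro generated_subalgebra_minimal) (auto simp: centralizer_def)
    then show "z \<in> centralizer (generated_subalgebra X)"
      by (auto simp: centralizer_def)
  qed
qed

lemma lie_ideal_if_generators:
  assumes I: "subspace I" and gen: "generated_subalgebra X = UNIV"
    and X: "\<And>x y. x \<in> X \<Longrightarrow> y \<in> I \<Longrightarrow> bracket x y \<in> I"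
  shows "lie_ideal I"
proof -
  let ?N = "{x. \<forall>y\<in>I. bracket x y \<in> I}"
  have "bracket (bracket x x') y \<in> I" if "x \<in> ?N" "x' \<in> ?N" "y \<in> I" for x x' y
  proof -
    have "bracket (bracket x x') y = bracket x (bracket x' y) - bracket x' (bracket x y)"
      by (simp add: bracket_derivation[of x x' y])
    then show ?thesis using that I by (auto intro: subspace_diff)
  qed
  then have "lie_subalgebra ?N"
    using I by (auto simp: lie_subalgebra_def subspace_def bracket_add_left bracket_scale_left)
  then have "generated_subalgebra X \<subseteq> ?N"
    using X by (intro generated_subalgebra_minimal) auto
  then show ?thesis using gen I by (auto simp: lie_ideal_def)
qed

lemma automorphism_facts:
  assumes "finite_order_automorphism_on UNIV \<tau>"
  shows "\<tau> (x + y) = \<tau> x + \<tau> y" "\<tau> (scale c x) = scale c (\<tau> x)"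
    "\<tau> (bracket x y) = bracket (\<tau> x) (\<tau> y)" "bij \<tau>"
    "\<tau> 0 = 0" "\<tau> (- x) = - \<tau> x"
proof -
  show *: "\<tau> (x + y) = \<tau> x + \<tau> y" "\<tau> (scale c x) = scale c (\<tau> x)"
    "\<tau> (bracket x y) = bracket (\<tau> x) (\<tau> y)" "bij \<tau>" for x y c
    using assms by (auto simp: finite_order_automorphism_on_def lie_automorphism_on_def)
  show "\<tau> 0 = 0" using *(2)[of 0 0] by simp
  show "\<tau> (- x) = - \<tau> x" using *(2)[of "-1" x] by simp
qed

lemma finite_order_image_eq:
  assumes "finite_order_automorphism_on UNIV \<tau>" and sub: "\<tau> ` S \<subseteq> S"
  shows "\<tau> ` S = S"
proof
  from assms(1) obtain n where n: "n > 0" "\<And>x. (\<tau> ^^ n) x = x"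
    by (auto simp: finite_order_automorphism_on_def)
  have pow: "(\<tau> ^^ k) x \<in> S" if "x \<in> S" for x k
    by (induction k) (use that sub in auto)
  show "S \<subseteq> \<tau> ` S"
  proof
    fix x assume x: "x \<in> S"
    from n(1) obtain m where m: "n = Suc m" by (cases n) auto
    have "x = \<tau> ((\<tau> ^^ m) x)" using n(2)[of x] m by simp
    then show "x \<in> \<tau> ` S" using pow[OF x] by blast
  qed
qed (rule sub)

text \<open>This is the semisimplicity of a finite order operator at the eigenvalue \<open>-1\<close>: if
  \<open>(\<tau> + 1)\<^sup>2 h = 0\<close>, then \<open>\<tau>\<^sup>k h = (-1)\<^sup>k (h - k c)\<close> with \<open>c = (\<tau> + 1) h\<close>, which is not periodic in \<open>k\<close>
  unless \<open>c = 0\<close>.\<close>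

lemma finite_order_minus_one_semisimple:
  assumes fo: "finite_order_automorphism_on UNIV \<tau>"
    and c: "\<tau> (h + \<tau> h) = - (h + \<tau> h)"
  shows "\<tau> h = - h"
proof -
  note \<tau> = automorphism_facts[OF fo]
  define c where "c = h + \<tau> h"
  have \<tau>h: "\<tau> h = c - h" by (simp add: c_def)
  have \<tau>c: "\<tau> c = - c" using c by (simp add: c_def)
  from fo obtain n where n: "n > 0" "\<And>x. (\<tau> ^^ n) x = x"
    by (auto simp: finite_order_automorphism_on_def)
  have *: "(\<tau> ^^ k) h = scale ((-1) ^ k) (h - scale (of_nat k) c)" for k
  proof (induction k)
    case (Suc k)
    have "\<tau> (h - scale (of_nat k) c) = - (h - scale (of_nat (Suc k)) c)"
      using \<tau>(1)[of h "- scale (of_nat k) c"]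
      by (simp add: \<tau> \<tau>h \<tau>c scale_left_distrib algebra_simps)
    moreover have "(\<tau> ^^ Suc k) h = scale ((-1) ^ k) (\<tau> (h - scale (of_nat k) c))"
      by (simp only: funpow.simps comp_apply Suc \<tau>(2))
    ultimately show ?case by (simp add: scale_right_diff_distrib)
  qed simp
  \<comment> \<open>Twice the order makes the sign disappear.\<close>
  have "(\<tau> ^^ (2 * n)) h = h"
    using n(2) by (simp add: mult_2 funpow_add)
  then have "h = h - scale (of_nat (2 * n)) c"
    using *[of "2 * n"] by (simp add: power_mult)
  then have "scale (of_nat (2 * n)) c = 0" by simp
  then have "c = 0" using n(1) by (simp only: scale_eq_0_iff) simp
  then show ?thesis using \<tau>h by simp
qed

end

section \<open>The invariant form and the root spaces\<close>

context extended_affine_lie_algebra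
begin

lemma form_add_right: "form x (y + z) = form x y + form x z"
  and form_scale_right: "form x (scale c y) = c * form x y"
  using form_linear[of x] by (auto simp: Vector_Spaces.linear_iff)

lemma form_scale_left: "form (scale c y) x = c * form y x"
  using form_scale_right form_symmetric by metis

lemma form_zero_right [simp]: "form x 0 = 0"
  using form_scale_right[of x 0 0] by simp

lemma form_minus_right: "form x (- y) = - form x y"
  using form_scale_right[of x "-1" y] by simp

lemma form_diff_right: "form x (y - z) = form x y - form x z"
  using form_add_right[of x y "- z"] by (simp add: form_minus_right)

lemma subspace_H: "subspace H"
  using H_subalgebra by (auto simp: lie_subalgebra_def)

lemma H_abelian: "h \<in> H \<Longrightarrow> h' \<in> H \<Longrightarrow> bracket h h' = 0"
  using root_space_zero by (auto simp: root_space_def)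

lemma subspace_root_space: "subspace (root_space \<alpha>)"
  by (auto simp: subspace_def root_space_def bracket_add_right bracket_scale_right
      scale_right_distrib scale_left_commute)

lemma zero_in_roots: "(\<lambda>_. 0) \<in> roots"
  using H_nontrivial by (auto simp: roots_def root_space_zero dual_def)

lemma bracket_root_space:
  "x \<in> root_space \<alpha> \<Longrightarrow> y \<in> root_space \<beta> \<Longrightarrow> bracket x y \<in> root_space (\<alpha> + \<beta>)"
  by (auto simp: root_space_def bracket_derivation bracket_scale_left bracket_scale_right
      scale_left_distrib)

lemma dual_plus: "\<alpha> \<in> dual \<Longrightarrow> \<beta> \<in> dual \<Longrightarrow> \<alpha> + \<beta> \<in> dual"
  by (auto simp: dual_def algebra_simps)

lemma dual_uminus: "\<alpha> \<in> dual \<Longrightarrow> - \<alpha> \<in> dual"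
  by (auto simp: dual_def)

lemma root_spaces_orthogonal:
  assumes "\<alpha> \<in> dual" "\<beta> \<in> dual" "x \<in> root_space \<alpha>" "y \<in> root_space \<beta>" "form x y \<noteq> 0"
  shows "\<beta> = - \<alpha>"
proof
  fix h
  show "\<beta> h = (- \<alpha>) h"
  proof (cases "h \<in> H")
    case True
    have "\<alpha> h * form x y = form (bracket h x) y"
      using True assms by (simp add: root_space_def form_scale_left)
    also have "\<dots> = - form (bracket x h) y"
      by (subst bracket_anticommute) (simp add: form_minus_right form_symmetric[of _ y])
    also have "\<dots> = - (\<beta> h * form x y)"
      using True assms by (simp add: root_space_def form_scale_right form_invariant)
    finally have "(\<alpha> h + \<beta> h) * form x y = 0" by (simp add: algebra_simps)
    then show ?thesis using assms(5) by (simp add: add_eq_0_iff)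
  next
    case False
    then show ?thesis using assms by (simp add: dual_def)
  qed
qed

text \<open>Root spaces are orthogonal unless their roots are opposite, so non-degeneracy of the form on
  \<open>E\<close> becomes non-degeneracy of the pairing of \<open>E\<^sub>\<alpha>\<close> with \<open>E\<^bsub>-\<alpha>\<^esub>\<close>.\<close>

lemma root_space_pairing:
  assumes \<alpha>: "\<alpha> \<in> dual" and x: "x \<in> root_space \<alpha>" "x \<noteq> 0"
  obtains y where "y \<in> root_space (- \<alpha>)" "form x y = 1"
proof -
  have "\<exists>y\<in>root_space (- \<alpha>). form x y \<noteq> 0"
  proof (rule ccontr)
    assume no: "\<not> ?thesis"
    have "form x y = 0" if "\<beta> \<in> roots" "y \<in> root_space \<beta>" for \<beta> y
      using root_spaces_orthogonal[OF \<alpha> _ x(1) that(2)] no that by (auto simp: roots_def)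
    moreover have "subspace {y. form x y = 0}"
      by (auto simp: subspace_def form_add_right form_scale_right)
    ultimately have "span (\<Union>\<alpha>\<in>roots. root_space \<alpha>) \<subseteq> {y. form x y = 0}"
      by (intro span_minimal) auto
    then have "form x y = 0" for y using root_space_sum by auto
    with x(2) show False using form_nondegenerate by blast
  qed
  then obtain y where y: "y \<in> root_space (- \<alpha>)" "form x y \<noteq> 0" by blast
  show thesis
  proof
    show "scale (1 / form x y) y \<in> root_space (- \<alpha>)"
      using y subspace_root_space by (intro subspace_scale)
    show "form x (scale (1 / form x y) y) = 1"
      using y by (simp add: form_scale_right)
  qed
qed

lemma form_nondegenerate_on_H:
  assumes "h \<in> H" and "\<And>h'. h' \<in> H \<Longrightarrow> form h' h = 0"
  shows "h = 0"
proof (rule ccontr)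
  assume "h \<noteq> 0"
  moreover have "h \<in> root_space (\<lambda>_. 0)" using assms root_space_zero by simp
  moreover have "(\<lambda>_. 0) \<in> dual" by (auto simp: dual_def)
  ultimately obtain y where "y \<in> root_space (- (\<lambda>_. 0))" "form h y = 1"
    using root_space_pairing by blast
  moreover have "- (\<lambda>_. 0) = (\<lambda>_::'a. 0::complex)" by (auto simp: fun_eq_iff)
  ultimately show False
    using assms(2) root_space_zero form_symmetric by (metis zero_neq_one)
qed

lemma H_eqI:
  assumes "s \<in> H" "t \<in> H" "\<And>h. h \<in> H \<Longrightarrow> form h s = form h t"
  shows "s = t"
proof -
  have "s - t = 0"
    using assms subspace_diff[OF subspace_H] by (intro form_nondegenerate_on_H) (auto simp: form_diff_right)
  then show ?thesis by simp
qed

definition represents :: "'a \<Rightarrow> ('a \<Rightarrow> complex) \<Rightarrow> bool" where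
  "represents t \<alpha> \<longleftrightarrow> t \<in> H \<and> (\<forall>h\<in>H. \<alpha> h = form h t)"

lemma representing_vector_eq:
  assumes "represents t \<alpha>"
  shows "representing_vector \<alpha> = t"
  unfolding representing_vector_def
  using assms by (intro the_equality) (auto simp: represents_def intro!: H_eqI)

lemma represents_plus: "represents s \<alpha> \<Longrightarrow> represents t \<beta> \<Longrightarrow> represents (s + t) (\<alpha> + \<beta>)"
  using subspace_add[OF subspace_H] by (auto simp: represents_def form_add_right)

lemma represents_uminus: "represents t \<alpha> \<Longrightarrow> represents (- t) (- \<alpha>)"
  using subspace_neg[OF subspace_H] by (auto simp: represents_def form_minus_right)

lemma bracket_opposite_in_H:
  assumes "x \<in> root_space \<alpha>" "y \<in> root_space (- \<alpha>)"
  shows "bracket x y \<in> H" "h \<in> H \<Longrightarrow> form h (bracket x y) = \<alpha> h * form x y"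
proof -
  have "\<alpha> + - \<alpha> = (\<lambda>_. 0)" by (auto simp: fun_eq_iff)
  then show "bracket x y \<in> H"
    using bracket_root_space[OF assms] root_space_zero by simp
  show "form h (bracket x y) = \<alpha> h * form x y" if "h \<in> H"
    using assms that form_invariant[of h x y] by (simp add: root_space_def form_scale_left)
qed

lemma bracket_opposite:
  assumes "x \<in> root_space \<alpha>" "y \<in> root_space (- \<alpha>)" "represents t \<alpha>"
  shows "bracket x y = scale (form x y) t"
  using assms bracket_opposite_in_H[OF assms(1,2)] subspace_scale[OF subspace_H]
  by (intro H_eqI) (auto simp: represents_def form_scale_right)

text \<open>Normalized root vectors \<open>x \<in> E\<^sub>\<alpha>\<close>, \<open>y \<in> E\<^bsub>-\<alpha>\<^esub>\<close> produce \<open>t\<^sub>\<alpha>\<close> as \<open>[x, y]\<close>, so \<open>t\<^sub>\<alpha>\<close>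
  exists for every root.\<close>

lemma root_coroot_pair:
  assumes "\<alpha> \<in> roots"
  obtains x y where "x \<in> root_space \<alpha>" "y \<in> root_space (- \<alpha>)" "form x y = 1"
    "represents (bracket x y) \<alpha>"
proof -
  have \<alpha>: "\<alpha> \<in> dual" using assms by (simp add: roots_def)
  have "0 \<in> root_space \<alpha>" by (auto simp: root_space_def)
  then obtain x where x: "x \<in> root_space \<alpha>" "x \<noteq> 0"
    using assms by (auto simp: roots_def)
  from root_space_pairing[OF \<alpha> x] obtain y where y: "y \<in> root_space (- \<alpha>)" "form x y = 1" .
  have "represents (bracket x y) \<alpha>"
    using bracket_opposite_in_H[OF x(1) y(1)] y(2) by (auto simp: represents_def)
  then show thesis using x y that by blast
qed

lemma nonisotropic_iff:
  assumes "represents t \<alpha>"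
  shows "\<alpha> \<in> nonisotropic_roots \<longleftrightarrow> \<alpha> \<in> roots \<and> \<alpha> t \<noteq> 0"
  using assms representing_vector_eq[OF assms]
  by (auto simp: nonisotropic_roots_def isotropic_roots_def dual_form_def represents_def)

lemma nonisotropic_coroot_pair:
  assumes "\<alpha> \<in> nonisotropic_roots"
  obtains x y where "x \<in> root_space \<alpha>" "y \<in> root_space (- \<alpha>)" "form x y = 1"
    "represents (bracket x y) \<alpha>" "\<alpha> (bracket x y) \<noteq> 0"
  using assms root_coroot_pair nonisotropic_iff
  by (metis DiffD1 nonisotropic_roots_def)

lemma uminus_nonisotropic:
  assumes "\<alpha> \<in> nonisotropic_roots"
  shows "- \<alpha> \<in> nonisotropic_roots"
proof -
  from nonisotropic_coroot_pair[OF assms]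
  obtain x y where xy: "x \<in> root_space \<alpha>" "y \<in> root_space (- \<alpha>)" "form x y = 1"
    "represents (bracket x y) \<alpha>" "\<alpha> (bracket x y) \<noteq> 0" .
  have "y \<noteq> 0" using xy(3) by auto
  moreover have "\<alpha> \<in> dual" using assms by (auto simp: nonisotropic_roots_def roots_def)
  ultimately have roots: "- \<alpha> \<in> roots" using xy(2) dual_uminus by (auto simp: roots_def)
  have rep: "represents (- bracket x y) (- \<alpha>)" using xy(4) by (rule represents_uminus)
  have "\<alpha> (- bracket x y) = - \<alpha> (bracket x y)"
    using xy(4) rep by (auto simp: represents_def form_minus_right form_symmetric[of "- bracket x y"])
  then show ?thesis
    using xy(5) roots nonisotropic_iff[OF rep] by simp
qed

lemma root_space_subset_core: "\<alpha> \<in> nonisotropic_roots \<Longrightarrow> root_space \<alpha> \<subseteq> core"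
  unfolding core_def using subset_generated_subalgebra by blast

lemma centralizer_core:
  "centralizer core = {z. \<forall>\<alpha>\<in>nonisotropic_roots. \<forall>x\<in>root_space \<alpha>. bracket z x = 0}"
  unfolding core_def centralizer_generated_subalgebra by (auto simp: centralizer_def)

section \<open>The degree zero part of the core\<close>

text \<open>The vectors \<open>t\<^sub>\<alpha>\<close> are the coroots of the non-isotropic roots up to nonzero factors.\<close>

definition coroot_span :: "'a set" where
  "coroot_span = span (representing_vector ` nonisotropic_roots)"

text \<open>The core lies in the span of the root spaces \<open>E\<^sub>\<alpha>\<close> with \<open>\<alpha> \<noteq> 0\<close> represented by a vector of
  \<open>coroot_span\<close>, together with \<open>coroot_span\<close> itself: this span is a subalgebra since a bracket of
  degree zero is \<open>[x, y] = (x, y) t\<^sub>\<alpha>\<close>. The summands of nonzero degree are orthogonal to \<open>H\<close>, so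
  they do not contribute to an element of \<open>H\<close>.\<close>

lemma core_inter_H_subset_coroot_span: "core \<inter> H \<subseteq> coroot_span"
proof
  fix v assume v: "v \<in> core \<inter> H"
  \<comment> \<open>The last conjunct confines the degree zero part of \<open>X\<close>, a priori all of \<open>H\<close>.\<close>
  define X where "X = {x. \<exists>\<alpha> t. \<alpha> \<in> dual \<and> t \<in> coroot_span \<and> represents t \<alpha> \<and>
      x \<in> root_space \<alpha> \<and> (\<alpha> = (\<lambda>_. 0) \<longrightarrow> x \<in> coroot_span)}"
  have T: "subspace coroot_span" by (simp add: coroot_span_def)
  have "lie_subalgebra (span X)"
  proof (rule lie_subalgebra_span)
    fix x y assume "x \<in> X" "y \<in> X"
    then obtain \<alpha> s \<beta> t where
      \<alpha>: "\<alpha> \<in> dual" "s \<in> coroot_span" "represents s \<alpha>" "x \<in> root_space \<alpha>" and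
      \<beta>: "\<beta> \<in> dual" "t \<in> coroot_span" "represents t \<beta>" "y \<in> root_space \<beta>"
      unfolding X_def by blast
    have "bracket x y \<in> coroot_span" if "\<alpha> + \<beta> = (\<lambda>_. 0)"
    proof -
      have "\<beta> = - \<alpha>" using that by (auto simp: fun_eq_iff add_eq_0_iff)
      then have "bracket x y = scale (form x y) s"
        using bracket_opposite \<alpha> \<beta> by simp
      then show ?thesis using \<alpha>(2) T by (simp add: subspace_scale)
    qed
    moreover have "bracket x y \<in> root_space (\<alpha> + \<beta>)" using \<alpha> \<beta> by (intro bracket_root_space)
    moreover have "\<alpha> + \<beta> \<in> dual" using \<alpha> \<beta> by (intro dual_plus)
    moreover have "represents (s + t) (\<alpha> + \<beta>)" using \<alpha> \<beta> by (intro represents_plus)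
    moreover have "s + t \<in> coroot_span" using \<alpha> \<beta> T by (intro subspace_add)
    ultimately have "bracket x y \<in> X" unfolding X_def by blast
    then show "bracket x y \<in> span X" by (rule span_base)
  qed
  moreover have "(\<Union>\<alpha>\<in>nonisotropic_roots. root_space \<alpha>) \<subseteq> span X"
  proof (intro UN_least subsetI)
    fix \<alpha> x assume \<alpha>: "\<alpha> \<in> nonisotropic_roots" and x: "x \<in> root_space \<alpha>"
    from nonisotropic_coroot_pair[OF \<alpha>]
    obtain t where t: "represents t \<alpha>" "\<alpha> t \<noteq> 0" by blast
    have "t \<in> coroot_span"
      using \<alpha> representing_vector_eq[OF t(1)] by (auto simp: coroot_span_def intro!: span_base)
    moreover have "\<alpha> \<noteq> (\<lambda>_. 0)" using t(2) by auto
    moreover have "\<alpha> \<in> dual" using \<alpha> by (auto simp: nonisotropic_roots_def roots_def)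
    ultimately have "x \<in> X" using t x unfolding X_def by blast
    then show "x \<in> span X" by (rule span_base)
  qed
  ultimately have core_X: "core \<subseteq> span X"
    unfolding core_def by (intro generated_subalgebra_minimal)
  define D where "D = {x. \<exists>t\<in>coroot_span. \<forall>h\<in>H. form h x = form h t}"
  have "span X \<subseteq> D"
  proof (rule span_minimal)
    show "X \<subseteq> D"
    proof
      fix x assume "x \<in> X"
      then obtain \<alpha> where \<alpha>: "\<alpha> \<in> dual" "x \<in> root_space \<alpha>" "\<alpha> = (\<lambda>_. 0) \<longrightarrow> x \<in> coroot_span"
        unfolding X_def by blast
      show "x \<in> D"
      proof (cases "\<alpha> = (\<lambda>_. 0)")
        case False
        have "form h x = form h 0" if "h \<in> H" for h
        proof (rule ccontr)
          assume "form h x \<noteq> form h 0"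
          then have "form h x \<noteq> 0" by simp
          moreover have "h \<in> root_space (\<lambda>_. 0)" "(\<lambda>_. 0) \<in> dual"
            using that root_space_zero zero_in_roots by (auto simp: roots_def)
          ultimately have "\<alpha> = - (\<lambda>_. 0)" using \<alpha> root_spaces_orthogonal by blast
          with False show False by (auto simp: fun_eq_iff)
        qed
        moreover have "0 \<in> coroot_span" using T by (rule subspace_0)
        ultimately show ?thesis unfolding D_def by blast
      qed (use \<alpha> in \<open>auto simp: D_def\<close>)
    qed
    show "subspace D"
    proof (rule subspaceI)
      show "0 \<in> D"
        unfolding D_def using subspace_0[OF T] by blast
    next
      fix x y
      assume "x \<in> D"
        and "y \<in> D"
      then obtain s t where  "s \<in> coroot_span" "\<forall>h\<in>H. form h x = form h s"
        "t \<in> coroot_span" "\<forall>h\<in>H. form h y = form h t" unfolding D_def by blast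
      then show "x + y \<in> D"
        using subspace_add[OF T] by (auto simp: D_def form_add_right intro!: bexI[of _ "s + t"])
    next
      fix c x
      assume "x \<in> D"
      then obtain s where "s \<in> coroot_span" "\<forall>h\<in>H. form h x = form h s" unfolding D_def by blast
      then show "scale c x \<in> D"
        using subspace_scale[OF T] by (auto simp: D_def form_scale_right intro!: bexI[of _ "scale c s"])
    qed
  qed
  then obtain t where t: "t \<in> coroot_span" "\<And>h. h \<in> H \<Longrightarrow> form h v = form h t"
    using v core_X unfolding D_def by blast
  have "representing_vector ` nonisotropic_roots \<subseteq> H"
    using nonisotropic_coroot_pair representing_vector_eq
    by (smt (verit, best) image_subsetI represents_def)
  then have "coroot_span \<subseteq> H"
    unfolding coroot_span_def using subspace_H by (intro span_minimal)
  then have "v = t" using v t by (intro H_eqI) auto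
  then show "v \<in> coroot_span" using t by simp
qed

section \<open>Automorphisms inverting the non-isotropic root spaces\<close>

lemma defect_centralizes_core:
  assumes fo: "finite_order_automorphism_on UNIV \<tau>"
    and inv: "\<forall>\<alpha>\<in>nonisotropic_roots. \<tau> ` root_space \<alpha> = root_space (- \<alpha>)"
    and h: "h \<in> H"
  shows "h + \<tau> h \<in> centralizer core"
  unfolding centralizer_core
proof (intro CollectI ballI)
  fix \<alpha> x assume \<alpha>: "\<alpha> \<in> nonisotropic_roots" and x: "x \<in> root_space \<alpha>"
  have "- (- \<alpha>) = \<alpha>" by (auto simp: fun_eq_iff)
  then have "\<tau> ` root_space (- \<alpha>) = root_space \<alpha>"
    using inv[rule_format, OF uminus_nonisotropic[OF \<alpha>]] by simp
  then obtain y where y: "y \<in> root_space (- \<alpha>)" "x = \<tau> y" using x by blast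
  have "bracket (\<tau> h) x = \<tau> (bracket h y)"
    using y automorphism_facts[OF fo] by simp
  also have "bracket h y = scale (- \<alpha> h) y"
    using y h by (auto simp: root_space_def)
  also have "\<tau> (scale (- \<alpha> h) y) = - scale (\<alpha> h) x"
    using y automorphism_facts[OF fo] by simp
  finally show "bracket (h + \<tau> h) x = 0"
    using x h by (simp add: bracket_add_left root_space_def)
qed

text \<open>For non-isotropic \<open>\<alpha>\<close> the line \<open>[E\<^sub>\<alpha>, E\<^bsub>-\<alpha>\<^esub>]\<close> through \<open>t\<^sub>\<alpha>\<close> is mapped to itself, so
  \<open>t\<^sub>\<alpha> + \<tau> t\<^sub>\<alpha>\<close> is a multiple of \<open>t\<^sub>\<alpha>\<close> that centralizes the core; since \<open>t\<^sub>\<alpha>\<close> acts on \<open>E\<^sub>\<alpha>\<close> by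
  \<open>(\<alpha>, \<alpha>) \<noteq> 0\<close>, the multiple is zero.\<close>

lemma minus_one_on_coroot_span:
  assumes fo: "finite_order_automorphism_on UNIV \<tau>"
    and inv: "\<forall>\<alpha>\<in>nonisotropic_roots. \<tau> ` root_space \<alpha> = root_space (- \<alpha>)"
    and v: "v \<in> coroot_span"
  shows "\<tau> v = - v"
proof -
  note \<tau> = automorphism_facts[OF fo]
  have "\<tau> (representing_vector \<alpha>) = - representing_vector \<alpha>"
    if \<alpha>: "\<alpha> \<in> nonisotropic_roots" for \<alpha>
  proof -
    from nonisotropic_coroot_pair[OF \<alpha>] obtain x y where
      xy: "x \<in> root_space \<alpha>" "y \<in> root_space (- \<alpha>)" "form x y = 1"
        "represents (bracket x y) \<alpha>" "\<alpha> (bracket x y) \<noteq> 0" .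
    define t where "t = bracket x y"
    have t: "represents t \<alpha>" "\<alpha> t \<noteq> 0" "t \<in> H"
      using xy by (auto simp: t_def represents_def)
    have "- (- \<alpha>) = \<alpha>" by (auto simp: fun_eq_iff)
    then have "\<tau> y \<in> root_space \<alpha>" using inv[rule_format, OF uminus_nonisotropic[OF \<alpha>]] xy(2) by auto
    moreover have "\<tau> x \<in> root_space (- \<alpha>)" using inv[rule_format, OF \<alpha>] xy(1) by auto
    ultimately have "bracket (\<tau> y) (\<tau> x) = scale (form (\<tau> y) (\<tau> x)) t"
      using t(1) by (rule bracket_opposite)
    moreover have "\<tau> t = - bracket (\<tau> y) (\<tau> x)"
      by (simp add: t_def \<tau> bracket_anticommute[of "\<tau> x"])
    ultimately have \<tau>t: "t + \<tau> t = scale (1 - form (\<tau> y) (\<tau> x)) t"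
      by (simp add: scale_left_diff_distrib)
    have "t + \<tau> t \<in> centralizer core" using fo inv t(3) by (rule defect_centralizes_core)
    then have "bracket (t + \<tau> t) x = 0" using \<alpha> xy(1) by (simp add: centralizer_core)
    then have "scale ((1 - form (\<tau> y) (\<tau> x)) * \<alpha> t) x = 0"
      using xy(1) t(3) by (simp add: \<tau>t bracket_scale_left root_space_def)
    moreover have "x \<noteq> 0" using xy(3) form_symmetric[of 0 y] by auto
    ultimately have "1 - form (\<tau> y) (\<tau> x) = 0" using t(2) by auto
    then have "t + \<tau> t = 0" using \<tau>t by simp
    then show ?thesis
      using representing_vector_eq[OF t(1)] by (simp add: add_eq_0_iff)
  qed
  moreover have "subspace {v. \<tau> v = - v}"
    by (auto simp: subspace_def \<tau>)
  ultimately have "coroot_span \<subseteq> {v. \<tau> v = - v}"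
    unfolding coroot_span_def by (intro span_minimal) auto
  then show ?thesis using v by auto
qed

lemma chevalley_if_minus_one_on_H:
  assumes fo: "finite_order_automorphism_on UNIV \<tau>" and neg: "\<And>h. h \<in> H \<Longrightarrow> \<tau> h = - h"
  shows "chevalley_involution \<tau>"
proof -
  note \<tau> = automorphism_facts[OF fo]
  have iff: "\<tau> x \<in> root_space (- \<alpha>) \<longleftrightarrow> x \<in> root_space \<alpha>" for x \<alpha>
  proof -
    have "bracket h (\<tau> x) = scale ((- \<alpha>) h) (\<tau> x) \<longleftrightarrow> bracket h x = scale (\<alpha> h) x"
      if "h \<in> H" for h
    proof -
      have "bracket h (\<tau> x) = \<tau> (- bracket h x)"
        using neg[OF that] by (simp add: \<tau> bracket_minus_left)
      moreover have "scale ((- \<alpha>) h) (\<tau> x) = \<tau> (- scale (\<alpha> h) x)"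
        by (simp add: \<tau>)
      ultimately show ?thesis
        using \<tau>(4) by (metis bij_is_inj injD neg_equal_iff_equal)
    qed
    then show ?thesis by (simp add: root_space_def)
  qed
  have "\<tau> ` root_space \<alpha> = root_space (- \<alpha>)" for \<alpha>
  proof
    show "root_space (- \<alpha>) \<subseteq> \<tau> ` root_space \<alpha>"
    proof
      fix y assume "y \<in> root_space (- \<alpha>)"
      moreover obtain x where "y = \<tau> x" using \<tau>(4) by (meson bij_pointE)
      ultimately show "y \<in> \<tau> ` root_space \<alpha>" using iff by blast
    qed
  qed (use iff in auto)
  with fo show ?thesis by (simp add: chevalley_involution_def)
qed

text \<open>The defect \<open>c = h + \<tau> h\<close> lies in \<open>H\<close> by stability and in the core by tameness, hence in
  \<open>coroot_span\<close>, where \<open>\<tau>\<close> is \<open>-1\<close>.\<close>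

lemma chevalley_if_stabilizes_H:
  assumes fo: "finite_order_automorphism_on UNIV \<tau>"
    and inv: "\<forall>\<alpha>\<in>nonisotropic_roots. \<tau> ` root_space \<alpha> = root_space (- \<alpha>)"
    and H: "\<tau> ` H \<subseteq> H"
  shows "chevalley_involution \<tau>"
  using fo
proof (rule chevalley_if_minus_one_on_H)
  fix h assume h: "h \<in> H"
  have "h + \<tau> h \<in> H" using h H subspace_add[OF subspace_H] by auto
  moreover have "h + \<tau> h \<in> core" using defect_centralizes_core[OF fo inv h] tame by blast
  ultimately have "h + \<tau> h \<in> coroot_span" using core_inter_H_subset_coroot_span by blast
  then have "\<tau> (h + \<tau> h) = - (h + \<tau> h)" by (rule minus_one_on_coroot_span[OF fo inv])
  with fo show "\<tau> h = - h" by (rule finite_order_minus_one_semisimple)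
qed

lemma chevalley_stabilizes_H:
  assumes "chevalley_involution \<tau>"
  shows "\<tau> ` H = H"
proof -
  have "- (\<lambda>_. 0) = (\<lambda>_::'a. 0::complex)" by (auto simp: fun_eq_iff)
  then show ?thesis
    using assms zero_in_roots root_space_zero unfolding chevalley_involution_def by metis
qed

lemma core_chevalley_inverts:
  assumes "core_chevalley_involution (restrict \<tau> core)"
  shows "\<forall>\<alpha>\<in>nonisotropic_roots. \<tau> ` root_space \<alpha> = root_space (- \<alpha>)"
proof
  fix \<alpha> assume \<alpha>: "\<alpha> \<in> nonisotropic_roots"
  have "restrict \<tau> core ` root_space \<alpha> = \<tau> ` root_space \<alpha>"
    using root_space_subset_core[OF \<alpha>] by (intro image_cong) auto
  then show "\<tau> ` root_space \<alpha> = root_space (- \<alpha>)"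
    using assms \<alpha> by (auto simp: core_chevalley_involution_def)
qed

lemma chevalley_restricts_to_core:
  assumes ch: "chevalley_involution \<tau>"
  shows "core_chevalley_involution (restrict \<tau> core)"
proof -
  have fo: "finite_order_automorphism_on UNIV \<tau>"
    using ch by (simp add: chevalley_involution_def)
  note \<tau> = automorphism_facts[OF fo]
  have inv: "\<tau> ` root_space \<alpha> = root_space (- \<alpha>)" if "\<alpha> \<in> nonisotropic_roots" for \<alpha>
    using ch that by (auto simp: chevalley_involution_def nonisotropic_roots_def)
  have core: "lie_subalgebra core" unfolding core_def by (rule lie_subalgebra_generated)
  have "lie_subalgebra {x. \<tau> x \<in> core}"
    using core by (auto simp: lie_subalgebra_def subspace_def \<tau>)
  moreover have "\<tau> x \<in> core" if "\<alpha> \<in> nonisotropic_roots" "x \<in> root_space \<alpha>" for \<alpha> x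
    using inv root_space_subset_core uminus_nonisotropic that by blast
  ultimately have "core \<subseteq> {x. \<tau> x \<in> core}"
    by (subst (1) core_def, intro generated_subalgebra_minimal) auto
  then have img: "\<tau> ` core = core" by (intro finite_order_image_eq[OF fo]) auto
  have pow: "(restrict \<tau> core ^^ k) x = (\<tau> ^^ k) x \<and> (\<tau> ^^ k) x \<in> core" if "x \<in> core" for x k
    by (induction k) (use that img in auto)
  have "bij_betw \<tau> core core"
    using img \<tau>(4) by (metis bij_betw_def bij_betw_imp_inj_on inj_on_subset subset_UNIV)
  then have "bij_betw (restrict \<tau> core) core core"
    by (simp cong: bij_betw_cong)
  moreover obtain n where "n > 0" "\<And>x. (\<tau> ^^ n) x = x"
    using fo by (auto simp: finite_order_automorphism_on_def)
  ultimately have "finite_order_automorphism_on core (restrict \<tau> core)"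
    unfolding finite_order_automorphism_on_def lie_automorphism_on_def
    using core pow by (auto simp: \<tau> lie_subalgebra_def subspace_def)
  moreover have "restrict \<tau> core ` root_space \<alpha> = \<tau> ` root_space \<alpha>"
    if "\<alpha> \<in> nonisotropic_roots" for \<alpha>
    using root_space_subset_core[OF that] by (intro image_cong) auto
  ultimately show ?thesis using inv by (simp add: core_chevalley_involution_def)
qed

section \<open>Kac-Moody algebras\<close>

text \<open>From \<open>\<alpha>\<^sub>i\<^sup>\<or> = [e\<^sub>i, f\<^sub>i]\<close> being a multiple of \<open>t\<close> for \<open>t = t\<^bsub>\<alpha>\<^sub>i\<^esub>\<close> and \<open>\<alpha>\<^sub>i(\<alpha>\<^sub>i\<^sup>\<or>) = 2\<close> it follows that
  \<open>(\<alpha>\<^sub>i, \<alpha>\<^sub>i) = \<alpha>\<^sub>i(t) \<noteq> 0\<close>.\<close>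

lemma simple_root_nonisotropic:
  assumes \<alpha>: "\<alpha> \<in> dual" and e: "e \<in> root_space \<alpha>" and f: "f \<in> root_space (- \<alpha>)"
    and two: "\<alpha> (bracket e f) = 2"
  shows "\<alpha> \<in> nonisotropic_roots"
proof -
  have "\<alpha> (scale 0 0) = 0 * \<alpha> 0"
    using \<alpha> subspace_0[OF subspace_H] unfolding dual_def by blast
  then have "\<alpha> 0 = 0" by simp
  then have "e \<noteq> 0" using two by auto
  then have root: "\<alpha> \<in> roots" using \<alpha> e by (auto simp: roots_def)
  from root_coroot_pair[OF root] obtain t where t: "represents t \<alpha>" by blast
  then have "bracket e f = scale (form e f) t" using e f by (intro bracket_opposite)
  moreover have "\<alpha> (scale (form e f) t) = form e f * \<alpha> t"
    using \<alpha> t by (auto simp: dual_def represents_def)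
  ultimately have "\<alpha> t \<noteq> 0" using two by auto
  with root nonisotropic_iff[OF t] show ?thesis by simp
qed

text \<open>The centralizer \<open>C\<close> of the core is stable under \<open>H\<close> and, as the core contains the generators
  \<open>e\<^sub>i\<close> and \<open>f\<^sub>i\<close>, annihilated by them; so the span of \<open>[H, C]\<close> is an ideal. By
  invariance \<open>([h, c], h') = -(c, [h, h']) = 0\<close> for \<open>h' \<in> H\<close>, so this ideal is orthogonal to \<open>H\<close>
  and meets \<open>H\<close> only in \<open>0\<close>.\<close>

lemma centralizer_core_subset_H:
  fixes A :: "int^'i^'i::finite"
  assumes "affine_kac_moody A"
  shows "centralizer core \<subseteq> H"
proof -
  from assms have two: "A $ i $ i = 2" for i
    by (simp add: affine_kac_moody_def affine_cartan_matrix_def generalized_cartan_matrix_def)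
  from assms have km: "kac_moody A" by (simp add: affine_kac_moody_def)
  obtain \<alpha> \<alpha>v e f where
    real: "realization A \<alpha> \<alpha>v" and
    ef: "\<And>i. bracket (e i) (f i) = \<alpha>v i" and
    wt: "\<And>h i. h \<in> H \<Longrightarrow> bracket h (e i) = scale (\<alpha> i h) (e i)"
      "\<And>h i. h \<in> H \<Longrightarrow> bracket h (f i) = scale (- \<alpha> i h) (f i)" and
    gen: "generated_subalgebra (H \<union> range e \<union> range f) = UNIV" and
    ideal: "\<And>I. lie_ideal I \<Longrightarrow> I \<inter> H = {0} \<Longrightarrow> I = {0}"
  proof -
    from km obtain \<alpha> \<alpha>v e f where *: "realization A \<alpha> \<alpha>v"
        "\<forall>i j. bracket (e i) (f j) = (if i = j then \<alpha>v i else 0)"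
        "\<forall>h\<in>H. \<forall>i. bracket h (e i) = scale (\<alpha> i h) (e i) \<and>
                     bracket h (f i) = scale (- \<alpha> i h) (f i)"
        "generated_subalgebra (H \<union> range e \<union> range f) = UNIV"
        "\<forall>I. lie_ideal I \<longrightarrow> I \<inter> H = {0} \<longrightarrow> I = {0}"
      unfolding kac_moody_def by (elim exE conjE) (rule that)
    show thesis by (rule that[of \<alpha> \<alpha>v e f]) (use * in auto)
  qed
  have \<alpha>: "\<alpha> i \<in> dual" "\<alpha> i (\<alpha>v i) = 2" for i
    using real two by (auto simp: realization_def)
  have root_vectors: "e i \<in> root_space (\<alpha> i)" "f i \<in> root_space (- \<alpha> i)" for i
    using wt by (auto simp: root_space_def)
  have simple: "\<alpha> i \<in> nonisotropic_roots" for i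
    using \<alpha> root_vectors ef by (intro simple_root_nonisotropic[of _ "e i" "f i"]) auto
  define C where "C = centralizer core"
  have C_generators: "bracket (e i) c = 0" "bracket (f i) c = 0" if "c \<in> C" for c i
  proof -
    have "bracket c (e i) = 0" "bracket c (f i) = 0"
      using that simple[of i] uminus_nonisotropic[OF simple[of i]] root_vectors[of i]
      unfolding C_def centralizer_core by blast+
    then show "bracket (e i) c = 0" "bracket (f i) c = 0"
      using bracket_anticommute[of _ c] by simp_all
  qed
  have C_H: "bracket h c \<in> C" if "h \<in> H" "c \<in> C" for h c
    unfolding C_def centralizer_core
  proof (intro CollectI ballI)
    fix \<beta> x assume \<beta>: "\<beta> \<in> nonisotropic_roots" and x: "x \<in> root_space \<beta>"
    have "bracket c x = 0" using that(2) \<beta> x by (simp add: C_def centralizer_core)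
    moreover have "bracket c (bracket h x) = 0"
      using x that(1) \<open>bracket c x = 0\<close> by (simp add: root_space_def bracket_scale_right)
    ultimately show "bracket (bracket h c) x = 0"
      using bracket_derivation[of h c x] by simp
  qed
  define G where "G = {bracket h c |h c. h \<in> H \<and> c \<in> C}"
  have "lie_ideal (span G)"
    using subspace_span gen
  proof (rule lie_ideal_if_generators)
    fix x y assume x: "x \<in> H \<union> range e \<union> range f" and y: "y \<in> span G"
    have "bracket x g \<in> span G" if "g \<in> G" for g
    proof -
      from that have "g \<in> C" using C_H by (auto simp: G_def)
      then consider "bracket x g = 0" | "bracket x g \<in> G"
        using x C_generators unfolding G_def by blast
      then show ?thesis by cases (auto intro: span_zero span_base)
    qed
    then show "bracket x y \<in> span G" using y by (intro bracket_span_subset[OF _ subspace_span y])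
  qed
  moreover have "span G \<inter> H = {0}"
  proof -
    have "form h' g = 0" if "h' \<in> H" "g \<in> G" for h' g
    proof -
      from that obtain h c where g: "g = bracket h c" "h \<in> H" by (auto simp: G_def)
      then have "form h' g = form (bracket h' h) c" by (simp add: form_invariant)
      also have "\<dots> = 0" using H_abelian[OF that(1) g(2)] form_symmetric[of 0 c] by simp
      finally show ?thesis .
    qed
    moreover have "subspace {g. \<forall>h'\<in>H. form h' g = 0}"
      by (auto simp: subspace_def form_add_right form_scale_right)
    ultimately have "span G \<subseteq> {g. \<forall>h'\<in>H. form h' g = 0}"
      by (intro span_minimal) auto
    then have "span G \<inter> H \<subseteq> {0}" using form_nondegenerate_on_H by blast
    then show ?thesis using span_zero[of G] subspace_0[OF subspace_H] by blast
  qed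
  ultimately have "span G = {0}" by (rule ideal)
  then have "bracket h c = 0" if "h \<in> H" "c \<in> C" for h c
    using span_base[of "bracket h c" G] that by (auto simp: G_def)
  then have "C \<subseteq> root_space (\<lambda>_. 0)" by (auto simp: root_space_def)
  then show ?thesis using root_space_zero by (simp add: C_def)
qed

lemma kac_moody_core_chevalley_stabilizes_H:
  fixes A :: "int^'i^'i::finite"
  assumes km: "affine_kac_moody A" and fo: "finite_order_automorphism_on UNIV \<tau>"
    and inv: "\<forall>\<alpha>\<in>nonisotropic_roots. \<tau> ` root_space \<alpha> = root_space (- \<alpha>)"
  shows "\<tau> ` H \<subseteq> H"
proof (rule image_subsetI)
  fix h assume h: "h \<in> H"
  then have "h + \<tau> h \<in> H"
    using defect_centralizes_core[OF fo inv h] centralizer_core_subset_H[OF km] by blast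
  then have "(h + \<tau> h) - h \<in> H" using h by (intro subspace_diff[OF subspace_H])
  then show "\<tau> h \<in> H" by simp
qed

end

theorem corollary3p1p5:
  fixes scale :: "complex \<Rightarrow> 'a::ab_group_add \<Rightarrow> 'a"
    and bracket :: "'a \<Rightarrow> 'a \<Rightarrow> 'a"
    and form :: "'a \<Rightarrow> 'a \<Rightarrow> complex"
    and H :: "'a set"
    and \<tau> :: "'a \<Rightarrow> 'a"
  assumes "extended_affine_lie_algebra scale bracket form H"
    and "lie_algebra.finite_order_automorphism_on scale bracket UNIV \<tau>"
  shows "(lie_algebra_with_form.core_chevalley_involution scale bracket form H
            (restrict \<tau> (lie_algebra_with_form.core scale bracket form H)) \<longrightarrow>
          (lie_algebra_with_form.chevalley_involution scale bracket H \<tau> \<longleftrightarrow> \<tau> ` H = H)) \<and>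
         (\<forall>A :: int^'i^'i::finite.
            lie_algebra_with_form.affine_kac_moody scale bracket H A \<longrightarrow>
            (lie_algebra_with_form.chevalley_involution scale bracket H \<tau> \<longleftrightarrow>
             lie_algebra_with_form.core_chevalley_involution scale bracket form H
               (restrict \<tau> (lie_algebra_with_form.core scale bracket form H))))"
proof -
  interpret extended_affine_lie_algebra scale bracket form H by (rule assms(1))
  note fo = assms(2)
  have "chevalley_involution \<tau> \<longleftrightarrow> \<tau> ` H = H"
    if "core_chevalley_involution (restrict \<tau> core)"
    using chevalley_stabilizes_H chevalley_if_stabilizes_H[OF fo core_chevalley_inverts[OF that]]
    by blast
  moreover have "chevalley_involution \<tau> \<longleftrightarrow> core_chevalley_involution (restrict \<tau> core)"
    if km: "affine_kac_moody A" for A :: "int^'i^'i::finite"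
  proof
    assume "core_chevalley_involution (restrict \<tau> core)"
    note inv = core_chevalley_inverts[OF this]
    show "chevalley_involution \<tau>"
      using fo inv kac_moody_core_chevalley_stabilizes_H[OF km fo inv]
      by (rule chevalley_if_stabilizes_H)
  qed (rule chevalley_restricts_to_core)
  ultimately show ?thesis by blast
qed

end
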